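(* Let $X$ be a $P$-space. If $X$ is a locally Lindelöf and $c$-well-filtered space, then $X$ is countably sober.
   Context: Let $X$ be a topological space. For points $x,y\in X$ write $x\le y$ if $x\in\mathrm{cl}(\{y\})$ (the specialization relation), and $\mathord{\downarrow}x=\{y\in X: y\le x\}=\mathrm{cl}(\{x\})$. A subset is saturated if it is an intersection of open sets (equivalently, an upper set for the specialization relation). A subset $A$ of $X$ is a Lindelöf set if every open cover of $A$ has a countable subcover. $\mathcal{LQ}(X)$ denotes the set of all saturated Lindelöf subsets of $X$, and $\mathrm{int}(K)$ denotes the interior of $K$. A nonempty family of sets is countably filtered if for every countable subfamily there is a member of the family contained in every member of the subfamily. $X$ is $c$-well-filtered if for every countably filtered family $\{K_i\}_{i\in I}$ of saturated Lindelöf subsets of $X$ and each open subset $U$ with $\bigcap_{i\in I}K_i\subseteq U$, there is $i_0\in I$ with $K_{i_0}\subseteq U$. $X$ is locally Lindelöf if for every open subset $U$ of $X$ and every point $x\in U$ there is $K\in\mathcal{LQ}(X)$ with $x\in\mathrm{int}(K)\subseteq K\subseteq U$. $X$ is a $P$-space if for every point $p\in X$ the neighbourhood system of $p$ is closed under countable intersections. A nonempty closed set $A$ is countably irreducible if whenever $A\subseteq\bigcup_{n\in\mathbb{N}}F_n$ with all $F_n$ closed, then $A\subseteq F_n$ for some $n$ (equivalently, whenever $(U_n)_{n\in\mathbb{N}}$ are open sets each meeting $A$, then $A\cap\bigcap_{n}U_n\neq\emptyset$). $X$ is countably sober if and only if for every countably irreducible closed subset $A$ of $X$ there exists a unique element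 $x\in X$ such that $A=\mathord{\downarrow}x$.
   Formalization: The space is additionally assumed to be T0: the uniqueness in countable sobriety forces T0, and the two-point indiscrete space is a locally Lindelöf, c-well-filtered P-space that is not countably sober. *)

theory Defs
  imports "HOL-Analysis.Analysis"
begin

definition specialization_le :: "'a topology \<Rightarrow> 'a \<Rightarrow> 'a \<Rightarrow> bool" where
  "specialization_le X x y \<longleftrightarrow> x \<in> X closure_of {y}"

definition down_set :: "'a topology \<Rightarrow> 'a \<Rightarrow> 'a set" where
  "down_set X x = {y \<in> topspace X. specialization_le X y x}"

lemma down_set_eq_closure_of: "down_set X x = X closure_of {x}"
  using closure_of_subset_topspace[of X "{x}"]
  by (auto simp: down_set_def specialization_le_def)

(* The factor topspace X makes the intersection of the empty family the whole space. *)
definition saturated_in :: "'a topology \<Rightarrow> 'a set \<Rightarrow> bool" where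
  "saturated_in X A \<longleftrightarrow>
     (\<exists>\<U>. (\<forall>U\<in>\<U>. openin X U) \<and> A = topspace X \<inter> \<Inter>\<U>)"

definition LQ :: "'a topology \<Rightarrow> 'a set set" where
  "LQ X = {K. K \<subseteq> topspace X \<and> saturated_in X K \<and> Lindelof_space (subtopology X K)}"

definition countably_filtered :: "'a set set \<Rightarrow> bool" where
  "countably_filtered \<K> \<longleftrightarrow>
     \<K> \<noteq> {} \<and> (\<forall>\<C>. \<C> \<subseteq> \<K> \<and> countable \<C> \<longrightarrow> (\<exists>K\<in>\<K>. \<forall>C\<in>\<C>. K \<subseteq> C))"

definition c_well_filtered :: "'a topology \<Rightarrow> bool" where
  "c_well_filtered X \<longleftrightarrow>
     (\<forall>\<K> U. \<K> \<subseteq> LQ X \<and> countably_filtered \<K> \<and> openin X U \<and> \<Inter>\<K> \<subseteq> U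
        \<longrightarrow> (\<exists>K\<in>\<K>. K \<subseteq> U))"

definition locally_Lindelof :: "'a topology \<Rightarrow> bool" where
  "locally_Lindelof X \<longleftrightarrow>
     (\<forall>U x. openin X U \<and> x \<in> U \<longrightarrow>
        (\<exists>K\<in>LQ X. x \<in> X interior_of K \<and> K \<subseteq> U))"

definition neighbourhoods :: "'a topology \<Rightarrow> 'a \<Rightarrow> 'a set set" where
  "neighbourhoods X p = {N. N \<subseteq> topspace X \<and> (\<exists>U. openin X U \<and> p \<in> U \<and> U \<subseteq> N)}"

definition P_space :: "'a topology \<Rightarrow> bool" where
  "P_space X \<longleftrightarrow>
     (\<forall>p\<in>topspace X. \<forall>\<N>. \<N> \<subseteq> neighbourhoods X p \<and> countable \<N> \<and> \<N> \<noteq> {}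
        \<longrightarrow> \<Inter>\<N> \<in> neighbourhoods X p)"

definition countably_irreducible :: "'a topology \<Rightarrow> 'a set \<Rightarrow> bool" where
  "countably_irreducible X A \<longleftrightarrow>
     A \<noteq> {} \<and> closedin X A \<and>
     (\<forall>F :: nat \<Rightarrow> 'a set. (\<forall>n. closedin X (F n)) \<and> A \<subseteq> (\<Union>n. F n) \<longrightarrow> (\<exists>n. A \<subseteq> F n))"

(* Uniqueness of the generating point makes every countably sober space a T0 space. *)
definition countably_sober :: "'a topology \<Rightarrow> bool" where
  "countably_sober X \<longleftrightarrow>
     (\<forall>A. countably_irreducible X A \<longrightarrow> (\<exists>!x. x \<in> topspace X \<and> A = down_set X x))"

end

theory Submission
  imports Defs
begin

text \<open>
  Let \<open>A\<close> be a countably irreducible closed set. A point generates \<open>A\<close> precisely when it lies in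
  \<open>A\<close> and in every open set meeting \<open>A\<close>. Local Lindelofness turns the search for such a point into
  a question about saturated Lindelof sets: it suffices to find a point of \<open>A\<close> common to all
  saturated Lindelof sets \<open>K\<close> whose interior meets \<open>A\<close>, because every open set meeting \<open>A\<close>
  contains such a \<open>K\<close>.

  These sets form a countably filtered family. Given countably many of them, the intersection of
  their interiors is open since \<open>X\<close> is a P-space, and still meets \<open>A\<close> since \<open>A\<close> is countably
  irreducible; local Lindelofness then puts a further member of the family inside it
  (\<open>countably_filtered_LQ_meeting\<close>). If the intersection of the family missed \<open>A\<close>, then
  \<open>c\<close>-well-filteredness, applied to the complement of \<open>A\<close>, would give a single member that misses
  \<open>A\<close>, which is absurd (\<open>c_well_filtered_meets_Inter_LQ_meeting\<close>). Hence the required point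
  exists, and the T0 axiom makes it unique.
\<close>

text \<open>
  The factor \<open>topspace X\<close> matters for \<open>\<U> = {}\<close>, where \<open>\<Inter>\<U>\<close> is the whole type. Adding the space itself to
  \<open>\<U>\<close> makes the family nonempty, as the defining condition of a P-space demands, without changing
  the intersection.
\<close>

lemma P_space_openin_countable_Inter:
  assumes "P_space X" and "countable \<U>" and "\<And>U. U \<in> \<U> \<Longrightarrow> openin X U"
  shows "openin X (topspace X \<inter> \<Inter>\<U>)"
proof (subst openin_subopen, intro ballI)
  fix x assume x: "x \<in> topspace X \<inter> \<Inter>\<U>"
  let ?\<N> = "insert (topspace X) \<U>"
  have "?\<N> \<subseteq> neighbourhoods X x"
  proof
    fix N assume "N \<in> ?\<N>"
    then have "openin X N" "x \<in> N"
      using assms(3) x by auto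
    then show "N \<in> neighbourhoods X x"
      unfolding neighbourhoods_def using openin_subset by blast
  qed
  moreover have "countable ?\<N>" "?\<N> \<noteq> {}" "x \<in> topspace X"
    using assms(2) x by auto
  ultimately have "\<Inter>?\<N> \<in> neighbourhoods X x"
    using assms(1) unfolding P_space_def by blast
  then show "\<exists>T. openin X T \<and> x \<in> T \<and> T \<subseteq> topspace X \<inter> \<Inter>\<U>"
    by (auto simp: neighbourhoods_def)
qed

text \<open>
  This is the form of countable irreducibility dual to the covering one: the complements of open
  sets meeting \<open>A\<close> are closed sets none of which contains \<open>A\<close>, so they cannot jointly cover \<open>A\<close>.
\<close>

lemma countably_irreducible_meets_countable_Inter:
  assumes A: "countably_irreducible X A" and "countable \<U>"
    and U: "\<And>U. U \<in> \<U> \<Longrightarrow> openin X U \<and> A \<inter> U \<noteq> {}"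
  shows "A \<inter> \<Inter>\<U> \<noteq> {}"
proof (cases "\<U> = {}")
  case True
  then show ?thesis using A by (simp add: countably_irreducible_def)
next
  case False
  define F where "F n = topspace X - from_nat_into \<U> n" for n
  have in_U: "from_nat_into \<U> n \<in> \<U>" for n
    using False by (rule from_nat_into)
  have closed: "closedin X (F n)" for n
    unfolding F_def using U[OF in_U[of n]] by (intro closedin_diff closedin_topspace) auto
  have proper: "\<not> A \<subseteq> F n" for n
    using U[OF in_U[of n]] by (auto simp: F_def)
  have "A \<subseteq> (\<Union>n. F n) \<longrightarrow> (\<exists>n. A \<subseteq> F n)"
    using A[unfolded countably_irreducible_def, THEN conjunct2, THEN conjunct2, rule_format, of F]
      closed by blast
  then obtain a where a: "a \<in> A" "\<And>n. a \<notin> F n"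
    using proper by blast
  moreover have "A \<subseteq> topspace X"
    using A by (auto simp: countably_irreducible_def dest: closedin_subset)
  ultimately have "a \<in> from_nat_into \<U> n" for n
    by (auto simp: F_def)
  then have "a \<in> \<Inter>\<U>"
    using from_nat_into_surj[OF \<open>countable \<U>\<close>] by blast
  then show ?thesis using a(1) by blast
qed

definition LQ_meeting :: "'a topology \<Rightarrow> 'a set \<Rightarrow> 'a set set" where
  "LQ_meeting X A = {K \<in> LQ X. A \<inter> X interior_of K \<noteq> {}}"

lemma locally_Lindelof_LQ_meeting:
  assumes "locally_Lindelof X" and "openin X U" and "x \<in> A \<inter> U"
  obtains K where "K \<in> LQ_meeting X A" and "K \<subseteq> U"
  using assms unfolding locally_Lindelof_def LQ_meeting_def by blast

text \<open>
  The P-space property and countable irreducibility cooperate here: the former keeps a countable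
  intersection of interiors open, the latter keeps it from leaving \<open>A\<close>, so that local
  Lindelofness can be applied at a point of \<open>A\<close> in that intersection.
\<close>

lemma countably_filtered_LQ_meeting:
  assumes P: "P_space X" and L: "locally_Lindelof X" and A: "countably_irreducible X A"
  shows "countably_filtered (LQ_meeting X A)"
proof -
  have A_space: "A \<subseteq> topspace X"
    using A by (auto simp: countably_irreducible_def dest: closedin_subset)
  have member_below: "\<exists>K\<in>LQ_meeting X A. \<forall>C\<in>\<C>. K \<subseteq> C"
    if \<C>: "\<C> \<subseteq> LQ_meeting X A" "countable \<C>" for \<C>
  proof -
    let ?\<U> = "(\<lambda>C. X interior_of C) ` \<C>"
    let ?V = "topspace X \<inter> \<Inter>?\<U>"
    have "openin X ?V"
      using P \<C>(2) by (intro P_space_openin_countable_Inter) auto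
    moreover have "A \<inter> \<Inter>?\<U> \<noteq> {}"
      using A \<C> by (intro countably_irreducible_meets_countable_Inter) (auto simp: LQ_meeting_def)
    then obtain x where "x \<in> A \<inter> ?V"
      using A_space by blast
    ultimately obtain K where K: "K \<in> LQ_meeting X A" "K \<subseteq> ?V"
      by (rule locally_Lindelof_LQ_meeting[OF L])
    have "K \<subseteq> C" if "C \<in> \<C>" for C
    proof -
      have "K \<subseteq> X interior_of C"
        using K(2) that by auto
      also have "\<dots> \<subseteq> C"
        by (rule interior_of_subset)
      finally show ?thesis .
    qed
    then show ?thesis using K(1) by auto
  qed
  \<comment> \<open>A lower bound of the empty subfamily is itself a member.\<close>
  then have "LQ_meeting X A \<noteq> {}"
    using member_below[of "{}"] by auto
  then show ?thesis
    using member_below unfolding countably_filtered_def by blast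
qed

text \<open>
  Otherwise the open complement of \<open>A\<close> contains the whole intersection, hence a single member of
  the family, although the interior of each member meets \<open>A\<close>.
\<close>

lemma c_well_filtered_meets_Inter_LQ_meeting:
  assumes "c_well_filtered X" and "countably_filtered (LQ_meeting X A)" and "closedin X A"
  shows "A \<inter> \<Inter>(LQ_meeting X A) \<noteq> {}"
proof
  assume disjoint: "A \<inter> \<Inter>(LQ_meeting X A) = {}"
  obtain K where "K \<in> LQ_meeting X A"
    using assms(2) by (auto simp: countably_filtered_def)
  then have "\<Inter>(LQ_meeting X A) \<subseteq> topspace X"
    by (auto simp: LQ_meeting_def LQ_def)
  then have "\<Inter>(LQ_meeting X A) \<subseteq> topspace X - A"
    using disjoint by blast
  moreover have "openin X (topspace X - A)"
    using assms(3) by blast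
  moreover have "LQ_meeting X A \<subseteq> LQ X"
    by (auto simp: LQ_meeting_def)
  ultimately obtain K where "K \<in> LQ_meeting X A" "K \<subseteq> topspace X - A"
    using assms(1,2) unfolding c_well_filtered_def by meson
  then show False
    using interior_of_subset[of X K] by (auto simp: LQ_meeting_def)
qed

text \<open>
  A point of \<open>A\<close> outside the closure of \<open>x\<close> would have, inside the complement of that closure, a
  Lindelof neighbourhood belonging to the family; but \<open>x\<close> lies in every member of the family.
\<close>

lemma closure_of_point_in_Inter_LQ_meeting:
  assumes "locally_Lindelof X" and A: "closedin X A" and x: "x \<in> A \<inter> \<Inter>(LQ_meeting X A)"
  shows "X closure_of {x} = A"
proof
  show "X closure_of {x} \<subseteq> A"
    using A x by (intro closure_of_minimal) auto
  show "A \<subseteq> X closure_of {x}"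
  proof
    fix y assume y: "y \<in> A"
    show "y \<in> X closure_of {x}"
    proof (rule ccontr)
      assume "y \<notin> X closure_of {x}"
      then have meets: "y \<in> A \<inter> (topspace X - X closure_of {x})"
        using y closedin_subset[OF A] by blast
      have "openin X (topspace X - X closure_of {x})"
        by (intro openin_diff openin_topspace closedin_closure_of)
      then obtain K where "K \<in> LQ_meeting X A" "K \<subseteq> topspace X - X closure_of {x}"
        using meets by (rule locally_Lindelof_LQ_meeting[OF assms(1)])
      moreover have "x \<in> X closure_of {x}"
        using x closedin_subset[OF A] by (auto simp: in_closure_of)
      ultimately show False
        using x by blast
    qed
  qed
qed

theorem proposition3p10:
  fixes X :: "'a topology"
  assumes "t0_space X"
    and "P_space X"
    and "locally_Lindelof X"
    and "c_well_filtered X"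
  shows "countably_sober X"
  unfolding countably_sober_def
proof (intro allI impI)
  fix A assume irr: "countably_irreducible X A"
  then have A: "closedin X A"
    by (simp add: countably_irreducible_def)
  have "countably_filtered (LQ_meeting X A)"
    using assms(2,3) irr by (rule countably_filtered_LQ_meeting)
  then obtain x where x: "x \<in> A \<inter> \<Inter>(LQ_meeting X A)"
    using c_well_filtered_meets_Inter_LQ_meeting assms(4) A by blast
  have "X closure_of {x} = A"
    using assms(3) A x by (rule closure_of_point_in_Inter_LQ_meeting)
  moreover have "x \<in> topspace X"
    using x closedin_subset[OF A] by blast
  moreover have "y = z"
    if "y \<in> topspace X" "z \<in> topspace X" "X closure_of {y} = X closure_of {z}" for y z
    using that assms(1) by (simp add: t0_space_closure_of_sing)
  ultimately show "\<exists>!x. x \<in> topspace X \<and> A = down_set X x"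
    unfolding down_set_eq_closure_of by metis
qed

end
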